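(* Let $B$ be a Banach space, $D\subseteq B$ a nonempty closed convex subset, and $T:D\to D$ a weak-contraction map, i.e. there exist constants $\delta\in(0,1)$ and $L\ge 0$ such that $\|Tx-Ty\|\le \delta\|x-y\|+L\|y-Ty\|$ for all $x,y\in D$. Assume that the set $F_T$ of fixed points of $T$ is nonempty. Let $\{a_n^1\}_{n=0}^\infty$ and $\{a_n^2\}_{n=0}^\infty$ be real sequences in $[0,1]$ with $\sum_{k=0}^\infty a_k^1a_k^2=\infty$, and let $\{x_n\}_{n=0}^\infty$ be the Picard-S iterative sequence of $T$ with these parameters, started at an arbitrary $x_0\in D$. Then $T$ has a unique fixed point $u^\ast$ and $\{x_n\}_{n=0}^\infty$ converges (in norm) to $u^\ast$.
   Context: $\mathbb{N}$ denotes the set of nonnegative integers. $F_T=\{x\in D: Tx=x\}$. The Picard-S iterative sequence of $T$ with parameters $\{a_n^1\},\{a_n^2\}\subset[0,1]$ and initial point $x_0\in D$ is defined, for $n\in\mathbb{N}$, by $$z_n=(1-a_n^2)x_n+a_n^2Tx_n,\qquad y_n=(1-a_n^1)Tx_n+a_n^1Tz_n,\qquad x_{n+1}=Ty_n.$$ *)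

theory Defs
  imports "HOL-Analysis.Analysis"
begin

(* The condition is not symmetric in x and y: only the displacement of y enters. *)
definition weak_contraction_on :: "'a::real_normed_vector set \<Rightarrow> ('a \<Rightarrow> 'a) \<Rightarrow> bool"
  where "weak_contraction_on D T \<longleftrightarrow>
    T \<in> D \<rightarrow> D \<and>
    (\<exists>\<delta> L :: real. 0 < \<delta> \<and> \<delta> < 1 \<and> 0 \<le> L \<and>
      (\<forall>x\<in>D. \<forall>y\<in>D. norm (T x - T y) \<le> \<delta> * norm (x - y) + L * norm (y - T y)))"

definition fixed_points :: "'a set \<Rightarrow> ('a \<Rightarrow> 'a) \<Rightarrow> 'a set"
  where "fixed_points D T = {x \<in> D. T x = x}"

definition picard_S_step :: "('a::real_vector \<Rightarrow> 'a) \<Rightarrow> real \<Rightarrow> real \<Rightarrow> 'a \<Rightarrow> 'a"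
  where "picard_S_step T a1 a2 x =
    (let z = (1 - a2) *\<^sub>R x + a2 *\<^sub>R T x;
         y = (1 - a1) *\<^sub>R T x + a1 *\<^sub>R T z
     in T y)"

primrec picard_S ::
  "('a::real_vector \<Rightarrow> 'a) \<Rightarrow> (nat \<Rightarrow> real) \<Rightarrow> (nat \<Rightarrow> real) \<Rightarrow> 'a \<Rightarrow> nat \<Rightarrow> 'a"
  where
    "picard_S T a1 a2 x0 0 = x0"
  | "picard_S T a1 a2 x0 (Suc n) = picard_S_step T (a1 n) (a2 n) (picard_S T a1 a2 x0 n)"

end

theory Submission
  imports Defs
begin

text \<open>
  Putting a fixed point \<open>u\<close> in the second argument of the weak-contraction inequality kills the
  displacement term, so \<open>T\<close> contracts distances to \<open>u\<close> by the factor \<open>\<delta>\<close>. This already forces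
  uniqueness. Balls around \<open>u\<close> are convex, so averaging never increases the distance to \<open>u\<close>, and
  each Picard-S step, which contains two nested applications of \<open>T\<close>, shrinks the distance to \<open>u\<close> by
  \<open>\<delta>\<^sup>2\<close>, whatever the parameters are.
\<close>

lemma convex_comb_mem:
  fixes x y :: "'a::real_vector"
  assumes "convex S" "x \<in> S" "y \<in> S" "a \<in> {0..1}"
  shows "(1 - a) *\<^sub>R x + a *\<^sub>R y \<in> S"
  using assms by (auto intro: convexD_alt)

text \<open>Working with the convex sets \<open>D \<inter> cball u r\<close> carries membership in
  \<open>D\<close> and the distance bound together through each average. \<open>maps\<close> is
  assumed for every radius because \<open>T\<close> is applied first at radius \<open>r\<close>,
  then at radius \<open>\<delta> * r\<close>.\<close>

lemma picard_S_step_mem: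
  fixes T :: "'a::real_normed_vector \<Rightarrow> 'a"
  assumes "convex D"
    and maps: "\<And>r. T ` (D \<inter> cball u r) \<subseteq> D \<inter> cball u (\<delta> * r)"
    and "\<delta> \<le> 1"
    and a: "a1 \<in> {0..1}" "a2 \<in> {0..1}"
    and x: "x \<in> D \<inter> cball u r"
  shows "picard_S_step T a1 a2 x \<in> D \<inter> cball u (\<delta>\<^sup>2 * r)"
proof -
  have conv: "convex (D \<inter> cball u s)" for s
    using \<open>convex D\<close> by (simp add: convex_Int)
  \<comment> \<open>The ball contains \<open>x\<close>, so its radius cannot be negative; otherwise
    scaling by \<open>\<delta>\<close> could enlarge it.\<close>
  have "0 \<le> r"
    using x order_trans[OF zero_le_dist, of u x r] by simp
  hence "\<delta> * r \<le> r"
    using \<open>\<delta> \<le> 1\<close> mult_right_mono[of \<delta> 1 r] by simp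
  define z where "z = (1 - a2) *\<^sub>R x + a2 *\<^sub>R T x"
  define y where "y = (1 - a1) *\<^sub>R T x + a1 *\<^sub>R T z"
  have Tx: "T x \<in> D \<inter> cball u (\<delta> * r)"
    using maps x by blast
  \<comment> \<open>\<open>z\<close> averages \<open>T x\<close> with \<open>x\<close>, which is
    only known to lie in the larger ball; the gain is recovered in \<open>T z\<close>.\<close>
  hence "T x \<in> D \<inter> cball u r"
    using \<open>\<delta> * r \<le> r\<close> by auto
  hence "z \<in> D \<inter> cball u r"
    unfolding z_def using conv x a by (intro convex_comb_mem)
  hence "T z \<in> D \<inter> cball u (\<delta> * r)"
    using maps by blast
  hence "y \<in> D \<inter> cball u (\<delta> * r)"
    unfolding y_def using conv Tx a by (intro convex_comb_mem)
  hence "T y \<in> D \<inter> cball u (\<delta> * (\<delta> * r))"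
    using maps by blast
  thus ?thesis
    by (simp add: picard_S_step_def y_def z_def power2_eq_square mult.assoc)
qed

theorem theorem1:
  fixes D :: "'a::banach set"
    and T :: "'a \<Rightarrow> 'a"
    and a1 a2 :: "nat \<Rightarrow> real"
    and x0 :: 'a
  assumes "D \<noteq> {}" and "closed D" and "convex D"
    and "weak_contraction_on D T"
    and "fixed_points D T \<noteq> {}"
    and "\<And>n. a1 n \<in> {0..1}"
    and "\<And>n. a2 n \<in> {0..1}"
    and "filterlim (\<lambda>n. \<Sum>k<n. a1 k * a2 k) at_top sequentially"
    and "x0 \<in> D"
  shows "\<exists>u. fixed_points D T = {u} \<and> picard_S T a1 a2 x0 \<longlonglongrightarrow> u"
proof -
  from \<open>weak_contraction_on D T\<close> obtain \<delta> L where \<delta>: "0 < \<delta>" "\<delta> < 1" "T \<in> D \<rightarrow> D"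
    and wc: "\<And>x y. x \<in> D \<Longrightarrow> y \<in> D \<Longrightarrow> norm (T x - T y) \<le> \<delta> * norm (x - y) + L * norm (y - T y)"
    unfolding weak_contraction_on_def by blast
  from \<open>fixed_points D T \<noteq> {}\<close> obtain u where u: "u \<in> D" "T u = u"
    by (auto simp: fixed_points_def)
  have contr: "dist u (T x) \<le> \<delta> * dist u x" if "x \<in> D" for x
    using wc[OF that u(1)] u(2) by (simp add: dist_norm norm_minus_commute)
  have "v = u" if v: "v \<in> D" "T v = v" for v
  proof (rule ccontr)
    assume "v \<noteq> u"
    hence "\<delta> * dist u v < dist u v"
      using \<delta> by simp
    thus False
      using contr[of v] v by simp
  qed
  hence "fixed_points D T = {u}"
    using u unfolding fixed_points_def by blast
  moreover have "picard_S T a1 a2 x0 \<longlonglongrightarrow> u"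
  proof -
    have maps: "T ` (D \<inter> cball u r) \<subseteq> D \<inter> cball u (\<delta> * r)" for r
    proof safe
      fix x assume x: "x \<in> D" "x \<in> cball u r"
      show "T x \<in> D"
        using \<delta> x by blast
      have "\<delta> * dist u x \<le> \<delta> * r"
        using x \<delta> by simp
      thus "T x \<in> cball u (\<delta> * r)"
        using contr[of x] x by simp
    qed
    \<comment> \<open>The starting radius \<open>dist u x0\<close> is the smallest that admits
      \<open>x0\<close>. Membership in \<open>D\<close> stays in the invariant since
      \<open>T\<close> contracts towards \<open>u\<close> only on \<open>D\<close>.\<close>
    have "picard_S T a1 a2 x0 n \<in> D \<inter> cball u ((\<delta>\<^sup>2) ^ n * dist u x0)" for n
    proof (induction n)
      case 0
      show ?case using \<open>x0 \<in> D\<close> by simp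
    next
      case (Suc n)
      from picard_S_step_mem[OF \<open>convex D\<close> maps _ assms(6,7) Suc] \<delta> show ?case
        by (simp add: mult.assoc)
    qed
    hence bound: "dist (picard_S T a1 a2 x0 n) u \<le> (\<delta>\<^sup>2) ^ n * dist u x0" for n
      by (simp add: dist_commute)
    have "(\<lambda>n. (\<delta>\<^sup>2) ^ n * dist u x0) \<longlonglongrightarrow> 0"
      using \<delta> by (intro tendsto_mult_left_zero LIMSEQ_power_zero) (simp add: abs_square_less_1)
    thus ?thesis
      by (rule metric_tendsto_imp_tendsto) (simp add: bound)
  qed
  ultimately show ?thesis
    by blast
qed

end
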